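(* Let $h>0$, $u_m\in\mathbb{R}$, $\boldsymbol{\alpha}=(\alpha_1,\dots,\alpha_N)^{\rm T}\in\mathbb{R}^N$, and let $\nu>0$, $\lambda>0$. The Newtonian slip friction term $$\mathbf{S}_{\rm Ns}(\boldsymbol{u}) = -\frac{\nu}{\lambda}u_b \begin{pmatrix} 0 \\ 1\\ \boldsymbol{r} \end{pmatrix} - \frac{\nu}{h} \begin{pmatrix} 0 \\ 0\\ \boldsymbol{C}\boldsymbol{\alpha} \end{pmatrix}\in\mathbb{R}^{N+2}$$ is entropy dissipative with respect to the entropy variables $\boldsymbol{w}$, namely $$\boldsymbol{w}^{\rm T}\,\mathbf{S}_{\rm Ns}(\boldsymbol{u})\leq 0.$$
   Context: $N\ge1$ is an integer, $\boldsymbol{u}=(h,hu_m,h\alpha_1,\dots,h\alpha_N)^{\rm T}$, $u_b=u_m+\alpha_1+\cdots+\alpha_N$ is the bottom velocity, $\boldsymbol{r}\in\mathbb{R}^N$ has components $r_i=2i+1$, and $\boldsymbol{C}=(C_{ij})\in\mathbb{R}^{N\times N}$ is given by $$C_{ij} = (2i+1)\int_0^1\phi_i'(\zeta)\phi_j'(\zeta)\,{\rm d}\zeta,\qquad i,j=1,\dots,N,$$ where $\phi_i(\zeta)=(-1)^iL_i(2\zeta-1)$ on $[0,1]$ and $L_i$ are the classical Legendre polynomials ($L_i(1)=1$). The constant $\lambda$ is the slip length and $\nu$ a viscosity parameter. The entropy variables $\boldsymbol{w}\in\mathbb{R}^{N+2}$ are $$w_1=-\frac{u_m^2}{2}-\frac12\sum_{i=1}^N\frac{\alpha_i^2}{2i+1}+g(h+b),\quad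 w_2=u_m,\quad w_{i+2}=\frac{\alpha_i}{2i+1}\ (i=1,\dots,N),$$ with $g>0$ the gravitational constant and $b\in\mathbb{R}$ the bathymetry value. *)

theory Defs
  imports
    "HOL-Analysis.Analysis"
    "HOL-Computational_Algebra.Polynomial"
    "Jordan_Normal_Form.Matrix"
begin

text \<open>Vectors and matrices are those of \<^theory>\<open>Jordan_Normal_Form.Matrix\<close>, whose dimension is
  a natural number; the clashing notation of the analysis library is switched off.\<close>

hide_type (open) Finite_Cartesian_Product.vec
hide_const (open) Finite_Cartesian_Product.vec
no_notation Finite_Cartesian_Product.vec_nth (infixl "$" 90)
no_notation Inner_Product.real_inner_class.inner (infix "\<bullet>" 70)

text \<open>Legendre polynomials by the formula of Rodrigues,
  \<open>L\<^sub>n(x) = 1 / (2^n n!) * d^n/dx^n (x^2 - 1)^n\<close>.\<close>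

definition legendre :: "nat \<Rightarrow> real poly" where
  "legendre n = Polynomial.smult (1 / (2 ^ n * fact n)) ((pderiv ^^ n) ([:-1, 0, 1:] ^ n))"

lemma poly_funpow_pderiv_root:
  fixes a :: real
  shows "poly ((pderiv ^^ n) ([:-a, 1:] ^ n * q)) a = fact n * poly q a"
proof (induction n arbitrary: q)
  case 0
  then show ?case by simp
next
  case (Suc n)
  let ?q = "Polynomial.smult (of_nat (Suc n)) q + [:-a, 1:] * pderiv q"
  have "pderiv ([:-a, 1:] ^ Suc n * q) = [:-a, 1:] ^ n * ?q"
    by (simp only: pderiv_mult pderiv_power_Suc) (simp add: pderiv_pCons algebra_simps)
  then show ?case
    using Suc.IH[of ?q] by (simp only: funpow_Suc_right o_apply) (simp add: algebra_simps)
qed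

lemma poly_legendre_1: "poly (legendre n) 1 = 1"
proof -
  have "[:-1, 0, 1:] = [:-1, 1:] * ([:1, 1:] :: real poly)"
    by simp
  then have "[:-1, 0, 1:] ^ n = [:-1, 1:] ^ n * ([:1, 1:] :: real poly) ^ n"
    by (metis power_mult_distrib)
  then show ?thesis
    using poly_funpow_pderiv_root[of n 1 "[:1, 1:] ^ n"] by (simp add: legendre_def poly_power)
qed

definition phi :: "nat \<Rightarrow> real \<Rightarrow> real" where
  "phi i \<zeta> = (-1) ^ i * poly (legendre i) (2 * \<zeta> - 1)"

text \<open>Vector and matrix entries are counted from \<open>0\<close>, so entry \<open>k\<close> of an \<open>N\<close>-vector
  belongs to the index \<open>i = k + 1\<close> with \<open>1 \<le> i \<le> N\<close>.\<close>

definition r_vec :: "nat \<Rightarrow> real vec" where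
  "r_vec N = vec N (\<lambda>k. 2 * real (k + 1) + 1)"

definition C_mat :: "nat \<Rightarrow> real mat" where
  "C_mat N = mat N N (\<lambda>(k, l). (2 * real (k + 1) + 1) *
     integral {0..1} (\<lambda>\<zeta>. deriv (phi (k + 1)) \<zeta> * deriv (phi (l + 1)) \<zeta>))"

definition bottom_velocity :: "nat \<Rightarrow> real \<Rightarrow> real vec \<Rightarrow> real" where
  "bottom_velocity N u\<^sub>m \<alpha> = u\<^sub>m + (\<Sum>k<N. \<alpha> $ k)"

text \<open>The source term and the entropy variables are written in terms of \<open>h\<close>, \<open>u\<^sub>m\<close>, \<open>\<alpha>\<close>,
  which for \<open>h > 0\<close> correspond bijectively to the state \<open>u = (h, h u\<^sub>m, h \<alpha>)\<close>.
  Viscosity and slip length are \<open>\<nu>\<close> and \<open>\<Lambda>\<close>.\<close>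

definition S_Ns :: "nat \<Rightarrow> real \<Rightarrow> real \<Rightarrow> real \<Rightarrow> real \<Rightarrow> real vec \<Rightarrow> real vec" where
  "S_Ns N \<nu> \<Lambda> h u\<^sub>m \<alpha> =
     (- (\<nu> / \<Lambda>) * bottom_velocity N u\<^sub>m \<alpha>) \<cdot>\<^sub>v (vec_of_list [0, 1] @\<^sub>v r_vec N)
     - (\<nu> / h) \<cdot>\<^sub>v (vec_of_list [0, 0] @\<^sub>v (C_mat N *\<^sub>v \<alpha>))"

definition entropy_vars ::
  "nat \<Rightarrow> real \<Rightarrow> real \<Rightarrow> real \<Rightarrow> real \<Rightarrow> real vec \<Rightarrow> real vec" where
  "entropy_vars N g b h u\<^sub>m \<alpha> =
     vec_of_list
       [- (u\<^sub>m\<^sup>2 / 2) - 1 / 2 * (\<Sum>k<N. (\<alpha> $ k)\<^sup>2 / (2 * real (k + 1) + 1)) + g * (h + b), u\<^sub>m]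
     @\<^sub>v vec N (\<lambda>k. \<alpha> $ k / (2 * real (k + 1) + 1))"

lemma S_Ns_carrier [simp]: "S_Ns N \<nu> \<Lambda> h u\<^sub>m \<alpha> \<in> carrier_vec (N + 2)"
  by (rule carrier_vecI) (simp add: S_Ns_def C_mat_def)

lemma entropy_vars_carrier [simp]: "entropy_vars N g b h u\<^sub>m \<alpha> \<in> carrier_vec (N + 2)"
  by (rule carrier_vecI) (simp add: entropy_vars_def)

end

theory Submission
  imports Defs
begin

text \<open>Pairing with the entropy variables undoes the weights \<open>2 i + 1\<close> of the moment equations:
  the vector \<open>(0, 1, r)\<close> pairs to \<open>u\<^sub>m + \<alpha>\<^sub>1 + \<dots> + \<alpha>\<^sub>N\<close>, the bottom velocity itself, and
  \<open>C \<alpha>\<close> pairs to the quadratic form of the stiffness matrix of the \<open>\<phi>\<^sub>i\<close>.  Hence the entropy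
  production is
    \<open>- \<nu> / \<Lambda> * u\<^sub>b\<^sup>2 - \<nu> / h * \<integral> (\<Sum>\<^sub>i \<alpha>\<^sub>i \<phi>\<^sub>i')\<^sup>2\<close>,
  where the first term is the dissipation by slip at the bottom and the second one the viscous
  dissipation of the vertical velocity profile (\<open>entropy_production_S_Ns\<close>).  Both terms are at
  most zero.  The derivatives of the \<open>\<phi>\<^sub>i\<close> are polynomials, hence continuous, and so
  the integral may be exchanged with the finite sums (\<open>C_mat_quadratic_form\<close>).\<close>

lemma deriv_phi: "deriv (phi i) \<zeta> = (-1) ^ i * (2 * poly (pderiv (legendre i)) (2 * \<zeta> - 1))"
proof -
  have "((\<lambda>\<zeta>. poly (legendre i) (2 * \<zeta> - 1)) has_real_derivative
      poly (pderiv (legendre i)) (2 * \<zeta> - 1) * 2) (at \<zeta>)"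
    by (rule DERIV_chain2[OF poly_DERIV]) (auto intro!: derivative_eq_intros)
  then have "(phi i has_real_derivative
      (-1) ^ i * (poly (pderiv (legendre i)) (2 * \<zeta> - 1) * 2)) (at \<zeta>)"
    unfolding phi_def[abs_def] by (rule DERIV_cmult)
  then show ?thesis
    by (simp add: DERIV_imp_deriv mult.commute)
qed

lemma continuous_on_deriv_phi: "continuous_on A (deriv (phi i))"
  unfolding deriv_phi[abs_def] by (intro continuous_intros)

text \<open>Dividing row \<open>i\<close> by \<open>2 i + 1\<close> symmetrises \<open>C\<close> into the Gram matrix of the \<open>\<phi>\<^sub>i'\<close> in
  \<open>L\<^sup>2(0, 1)\<close>, whose quadratic form is a squared norm.\<close>

lemma C_mat_quadratic_form:
  assumes "\<alpha> \<in> carrier_vec N"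
  shows "vec N (\<lambda>k. \<alpha> $ k / (2 * real (k + 1) + 1)) \<bullet> (C_mat N *\<^sub>v \<alpha>)
    = integral {0..1} (\<lambda>\<zeta>. (\<Sum>k<N. \<alpha> $ k * deriv (phi (k + 1)) \<zeta>)\<^sup>2)"
proof -
  let ?d = "\<lambda>k. deriv (phi (k + 1))"
  let ?G = "\<lambda>k l. integral {0..1} (\<lambda>\<zeta>. ?d k \<zeta> * ?d l \<zeta>)"
  have int: "(\<lambda>\<zeta>. \<alpha> $ k * \<alpha> $ l * (?d k \<zeta> * ?d l \<zeta>)) integrable_on {0..1}" for k l
    by (intro integrable_continuous_real continuous_intros continuous_on_deriv_phi)
  have row: "(C_mat N *\<^sub>v \<alpha>) $ k = (2 * real (k + 1) + 1) * (\<Sum>l<N. \<alpha> $ l * ?G k l)"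
    if "k < N" for k
    using that assms
    by (auto simp: C_mat_def scalar_prod_def sum_distrib_left lessThan_atLeast0 mult_ac
        simp del: of_nat_Suc intro!: sum.cong)
  have dim: "dim_vec (C_mat N *\<^sub>v \<alpha>) = N"
    by (simp add: C_mat_def)
  have weight: "\<alpha> $ k / (2 * real (k + 1) + 1) * (C_mat N *\<^sub>v \<alpha>) $ k
      = (\<Sum>l<N. \<alpha> $ k * \<alpha> $ l * ?G k l)" if "k < N" for k
  proof -
    have "2 * real (k + 1) + 1 \<noteq> 0" by linarith
    then show ?thesis
      unfolding row[OF that] by (simp add: sum_distrib_left mult.assoc)
  qed
  have "vec N (\<lambda>k. \<alpha> $ k / (2 * real (k + 1) + 1)) \<bullet> (C_mat N *\<^sub>v \<alpha>)
      = (\<Sum>k<N. \<alpha> $ k / (2 * real (k + 1) + 1) * (C_mat N *\<^sub>v \<alpha>) $ k)"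
    unfolding scalar_prod_def dim lessThan_atLeast0 by (intro sum.cong) auto
  also have "\<dots> = (\<Sum>k<N. \<Sum>l<N. \<alpha> $ k * \<alpha> $ l * ?G k l)"
    by (intro sum.cong weight) auto
  also have "\<dots> = (\<Sum>k<N. \<Sum>l<N. integral {0..1} (\<lambda>\<zeta>. \<alpha> $ k * \<alpha> $ l * (?d k \<zeta> * ?d l \<zeta>)))"
    by simp
  also have "\<dots> = integral {0..1} (\<lambda>\<zeta>. \<Sum>k<N. \<Sum>l<N. \<alpha> $ k * \<alpha> $ l * (?d k \<zeta> * ?d l \<zeta>))"
    by (simp only: integral_sum integrable_sum int finite_lessThan)
  also have "\<dots> = integral {0..1} (\<lambda>\<zeta>. (\<Sum>k<N. \<alpha> $ k * ?d k \<zeta>)\<^sup>2)"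
    by (simp add: power2_eq_square sum_product mult_ac)
  finally show ?thesis .
qed

text \<open>The first entropy variable, which carries the dependence on \<open>g\<close> and \<open>b\<close>, meets a zero
  entry, since friction does not act on the mass balance.\<close>

lemma entropy_production_S_Ns:
  assumes "\<alpha> \<in> carrier_vec N"
  shows "entropy_vars N g b h u\<^sub>m \<alpha> \<bullet> S_Ns N \<nu> \<Lambda> h u\<^sub>m \<alpha>
    = - (\<nu> / \<Lambda>) * (bottom_velocity N u\<^sub>m \<alpha>)\<^sup>2
      - \<nu> / h * integral {0..1} (\<lambda>\<zeta>. (\<Sum>k<N. \<alpha> $ k * deriv (phi (k + 1)) \<zeta>)\<^sup>2)"
proof -
  let ?w = "entropy_vars N g b h u\<^sub>m \<alpha>"
  let ?v = "vec N (\<lambda>k. \<alpha> $ k / (2 * real (k + 1) + 1))"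
  let ?slip = "vec_of_list [0, 1] @\<^sub>v r_vec N"
  let ?visc = "vec_of_list [0, 0] @\<^sub>v (C_mat N *\<^sub>v \<alpha>)"
  have carrier_r: "r_vec N \<in> carrier_vec N"
    by (simp add: r_vec_def)
  have carrier_C: "C_mat N *\<^sub>v \<alpha> \<in> carrier_vec N"
    by (rule carrier_vecI) (simp add: C_mat_def)
  have carrier_list: "vec_of_list [x, y] \<in> carrier_vec 2" for x y :: real
    by (rule carrier_vecI) simp
  have carrier_slip: "?slip \<in> carrier_vec (N + 2)" and carrier_visc: "?visc \<in> carrier_vec (N + 2)"
    using carrier_r carrier_C by (auto intro!: carrier_vecI)
  have pair: "vec_of_list [x, y] \<bullet> vec_of_list [x', y'] = x * x' + y * y'" for x y x' y' :: real
    by (simp add: scalar_prod_def)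
  have weight: "\<alpha> $ k / (2 * real (k + 1) + 1) * (2 * real (k + 1) + 1) = \<alpha> $ k" for k
  proof -
    have "2 * real (k + 1) + 1 \<noteq> 0" by linarith
    then show ?thesis by simp
  qed
  have "?v \<bullet> r_vec N
      = (\<Sum>k<N. \<alpha> $ k / (2 * real (k + 1) + 1) * (2 * real (k + 1) + 1))"
    unfolding scalar_prod_def r_vec_def lessThan_atLeast0 by (intro sum.cong) auto
  then have "?v \<bullet> r_vec N = (\<Sum>k<N. \<alpha> $ k)"
    by (simp only: weight)
  then have slip: "?w \<bullet> ?slip = bottom_velocity N u\<^sub>m \<alpha>"
    unfolding entropy_vars_def bottom_velocity_def
    by (subst scalar_prod_append[OF carrier_list _ carrier_list carrier_r]) (simp_all only: pair, auto)
  have visc: "?w \<bullet> ?visc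
      = integral {0..1} (\<lambda>\<zeta>. (\<Sum>k<N. \<alpha> $ k * deriv (phi (k + 1)) \<zeta>)\<^sup>2)"
    unfolding entropy_vars_def C_mat_quadratic_form[OF assms, symmetric]
    by (subst scalar_prod_append[OF carrier_list _ carrier_list carrier_C]) (simp_all only: pair, auto)
  have w: "?w \<in> carrier_vec (N + 2)"
    by (rule entropy_vars_carrier)
  have "?w \<bullet> S_Ns N \<nu> \<Lambda> h u\<^sub>m \<alpha>
      = - (\<nu> / \<Lambda>) * bottom_velocity N u\<^sub>m \<alpha> * (?w \<bullet> ?slip) - \<nu> / h * (?w \<bullet> ?visc)"
    unfolding S_Ns_def
    by (simp only: scalar_prod_minus_distrib[OF w smult_carrier_vec[THEN iffD2, OF carrier_slip]
          smult_carrier_vec[THEN iffD2, OF carrier_visc]]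
        scalar_prod_smult_distrib[OF w carrier_slip] scalar_prod_smult_distrib[OF w carrier_visc])
  then show ?thesis
    unfolding slip visc by (simp add: power2_eq_square)
qed

theorem lemma4:
  fixes N :: nat and h u\<^sub>m g b \<nu> \<Lambda> :: real and \<alpha> :: "real vec"
  assumes "N \<ge> 1"
    and "\<alpha> \<in> carrier_vec N"
    and "h > 0" and "g > 0" and "\<nu> > 0" and "\<Lambda> > 0"
  shows "entropy_vars N g b h u\<^sub>m \<alpha> \<bullet> S_Ns N \<nu> \<Lambda> h u\<^sub>m \<alpha> \<le> 0"
proof -
  have "0 \<le> integral {0..1} (\<lambda>\<zeta>. (\<Sum>k<N. \<alpha> $ k * deriv (phi (k + 1)) \<zeta>)\<^sup>2)"
    by (intro integral_nonneg integrable_continuous_real continuous_intros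
        continuous_on_deriv_phi) simp
  then have "0 \<le> \<nu> / h * integral {0..1} (\<lambda>\<zeta>. (\<Sum>k<N. \<alpha> $ k * deriv (phi (k + 1)) \<zeta>)\<^sup>2)"
    using \<open>h > 0\<close> \<open>\<nu> > 0\<close> by simp
  moreover have "0 \<le> \<nu> / \<Lambda> * (bottom_velocity N u\<^sub>m \<alpha>)\<^sup>2"
    using \<open>\<nu> > 0\<close> \<open>\<Lambda> > 0\<close> by simp
  ultimately show ?thesis
    unfolding entropy_production_S_Ns[OF \<open>\<alpha> \<in> carrier_vec N\<close>] by linarith
qed

end
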